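(* Let $n>4$ be an integer, let $G=QD_{2^n}=\langle a,b \mid a^{2^{n-1}}=1,\ b^2=1,\ baba^{2^{n-2}+1}=1\rangle$ be the quasidihedral group of order $2^n$, and let $d=2^m$ be a divisor of $2^n$. Then the transiso graph $\Gamma_d(G)$ is complete if and only if $d\neq 2$.
   Context: All groups are finite. Let $G$ be a finite group and $H\le G$. A normalized right transversal (NRT) of $H$ in $G$ is a subset $S\subseteq G$ containing exactly one element from each right coset of $H$ in $G$ and with $1\in S$. $\mathcal{T}(G,H)$ denotes the set of all NRTs of $H$ in $G$. Each NRT $S$ carries the binary operation $\circ$ defined by $\{x\circ y\}=S\cap Hxy$, which makes $S$ a right loop with identity $1$. Two NRTs (possibly of different subgroups) are isomorphic, written $S_1\cong S_2$, if there is a bijection between them preserving these operations. For a divisor $d$ of $|G|$, the transiso graph $\Gamma_d(G)$ is the simple graph whose vertices are the subgroups of $G$ of order $d$, two distinct vertices $H_1,H_2$ being adjacent if and only if there exist $S_1\in\mathcal{T}(G,H_1)$ and $S_2\in\mathcal{T}(G,H_2)$ with $S_1\cong S_2$. A graph is complete if any two distinct vertices are adjacent (so graphs with at most one vertex are complete). *)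

theory Defs
  imports "HOL-Algebra.Coset"
begin

section \<open>Groups given by generators and relators\<close>

text \<open>
  The letter \<open>(x, True)\<close> stands for the generator \<open>x\<close> and \<open>(x, False)\<close> for its formal inverse;
  the generators are all elements of the type \<open>'g\<close>.
\<close>

type_synonym 'g word = "('g \<times> bool) list"

inductive word_eq :: "'g word set \<Rightarrow> 'g word \<Rightarrow> 'g word \<Rightarrow> bool" for R where
  refl: "word_eq R u u"
| sym: "word_eq R u v \<Longrightarrow> word_eq R v u"
| trans: "word_eq R u v \<Longrightarrow> word_eq R v w \<Longrightarrow> word_eq R u w"
| cancel: "word_eq R (u @ [(x, e), (x, \<not> e)] @ v) (u @ v)"
| relator: "r \<in> R \<Longrightarrow> word_eq R (u @ r @ v) (u @ v)"

definition word_rel :: "'g word set \<Rightarrow> ('g word \<times> 'g word) set" where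
  "word_rel R = {(u, v). word_eq R u v}"

definition presented_group :: "'g word set \<Rightarrow> 'g word set monoid" where
  "presented_group R =
    \<lparr>carrier = UNIV // word_rel R,
     mult = (\<lambda>A B. \<Union>u\<in>A. \<Union>v\<in>B. word_rel R `` {u @ v}),
     one = word_rel R `` {[]}\<rparr>"

lemma word_eq_append_left: "word_eq R u v \<Longrightarrow> word_eq R (w @ u) (w @ v)"
proof (induction rule: word_eq.induct)
  case (cancel u x e v)
  show ?case using word_eq.cancel[of R "w @ u" x e v] by simp
next
  case (relator r u v)
  show ?case using word_eq.relator[OF relator, of "w @ u" v] by simp
qed (fact word_eq.refl, erule word_eq.sym, erule (1) word_eq.trans)

lemma word_eq_append_right: "word_eq R u v \<Longrightarrow> word_eq R (u @ w) (v @ w)"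
proof (induction rule: word_eq.induct)
  case (cancel u x e v)
  show ?case using word_eq.cancel[of R u x e "v @ w"] by simp
next
  case (relator r u v)
  show ?case using word_eq.relator[OF relator, of u "v @ w"] by simp
qed (fact word_eq.refl, erule word_eq.sym, erule (1) word_eq.trans)

lemma word_eq_append:
  "word_eq R u u' \<Longrightarrow> word_eq R v v' \<Longrightarrow> word_eq R (u @ v) (u' @ v')"
  by (rule word_eq.trans[OF word_eq_append_right word_eq_append_left])

lemma equiv_word_rel: "equiv UNIV (word_rel R)"
proof (rule equivI)
  show "refl (word_rel R)" by (simp add: refl_on_def word_rel_def word_eq.refl)
  show "sym (word_rel R)" by (rule symI) (simp add: word_rel_def word_eq.sym)
  show "trans (word_rel R)"
    by (rule transI) (unfold word_rel_def mem_Collect_eq prod.case, rule word_eq.trans)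
qed simp

lemma word_class_eq_iff: "word_rel R `` {u} = word_rel R `` {v} \<longleftrightarrow> word_eq R u v"
  using eq_equiv_class_iff[OF equiv_word_rel, of u v R] by (simp add: word_rel_def)

lemma presented_group_mult:
  "word_rel R `` {u} \<otimes>\<^bsub>presented_group R\<^esub> word_rel R `` {v} = word_rel R `` {u @ v}"
proof -
  have const: "word_rel R `` {u' @ v'} = word_rel R `` {u @ v}"
    if "u' \<in> word_rel R `` {u}" "v' \<in> word_rel R `` {v}" for u' v'
  proof -
    have "word_eq R u u'" "word_eq R v v'" using that by (simp_all add: word_rel_def)
    then show ?thesis unfolding word_class_eq_iff by (rule word_eq.sym[OF word_eq_append])
  qed
  have mem: "w \<in> word_rel R `` {w}" for w
    by (simp add: word_rel_def word_eq.refl)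
  have inner: "(\<Union>v'\<in>word_rel R `` {v}. word_rel R `` {u' @ v'}) = word_rel R `` {u @ v}"
    if "u' \<in> word_rel R `` {u}" for u'
    by (rule UN_constant_eq[OF mem], rule ballI, rule const[OF that])
  have "(\<Union>u'\<in>word_rel R `` {u}. \<Union>v'\<in>word_rel R `` {v}. word_rel R `` {u' @ v'})
      = word_rel R `` {u @ v}"
    by (rule UN_constant_eq[OF mem], rule ballI, rule inner)
  then show ?thesis unfolding presented_group_def monoid.simps .
qed

lemma word_inverse: "\<exists>v. word_eq R (v @ u) []"
proof (induction u)
  case Nil
  show ?case using word_eq.refl[of R "[]"] by auto
next
  case (Cons l u)
  then obtain v where v: "word_eq R (v @ u) []" by blast
  obtain x e where l: "l = (x, e)" by (cases l)
  have "word_eq R ((v @ [(x, \<not> e)]) @ l # u) (v @ u)"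
    using word_eq.cancel[of R v x "\<not> e" u] l by simp
  with v have "word_eq R ((v @ [(x, \<not> e)]) @ l # u) []" by (rule word_eq.trans[rotated])
  then show ?case by blast
qed

lemma group_presented_group: "group (presented_group R)"
proof (rule groupI)
  have class_in: "word_rel R `` {u} \<in> carrier (presented_group R)" for u
    by (simp add: presented_group_def quotientI)
  have class_ex: "\<exists>u. x = word_rel R `` {u}" if "x \<in> carrier (presented_group R)" for x
    using that by (simp add: presented_group_def) (erule quotientE, rule exI)
  have one: "\<one>\<^bsub>presented_group R\<^esub> = word_rel R `` {[]}"
    by (simp add: presented_group_def)
  show "\<one>\<^bsub>presented_group R\<^esub> \<in> carrier (presented_group R)"
    unfolding one by (rule class_in)
  fix x assume "x \<in> carrier (presented_group R)"
  from class_ex[OF this] obtain u where x: "x = word_rel R `` {u}" ..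
  show "\<one>\<^bsub>presented_group R\<^esub> \<otimes>\<^bsub>presented_group R\<^esub> x = x"
    unfolding one x presented_group_mult by simp
  obtain v where v: "word_eq R (v @ u) []" using word_inverse by blast
  have "word_rel R `` {v} \<otimes>\<^bsub>presented_group R\<^esub> x = \<one>\<^bsub>presented_group R\<^esub>"
    unfolding one x presented_group_mult word_class_eq_iff by (rule v)
  then show "\<exists>y\<in>carrier (presented_group R).
      y \<otimes>\<^bsub>presented_group R\<^esub> x = \<one>\<^bsub>presented_group R\<^esub>"
    by (rule bexI[OF _ class_in])
  fix y assume "y \<in> carrier (presented_group R)"
  from class_ex[OF this] obtain v where y: "y = word_rel R `` {v}" ..
  show "x \<otimes>\<^bsub>presented_group R\<^esub> y \<in> carrier (presented_group R)"
    unfolding x y presented_group_mult by (rule class_in)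
  fix z assume "z \<in> carrier (presented_group R)"
  from class_ex[OF this] obtain w where z: "z = word_rel R `` {w}" ..
  show "x \<otimes>\<^bsub>presented_group R\<^esub> y \<otimes>\<^bsub>presented_group R\<^esub> z =
      x \<otimes>\<^bsub>presented_group R\<^esub> (y \<otimes>\<^bsub>presented_group R\<^esub> z)"
    unfolding x y z presented_group_mult append_assoc ..
qed


section \<open>The quasidihedral group of order \<open>2 ^ n\<close>\<close>

datatype qd_gen = Gen_a | Gen_b

abbreviation "letter_a \<equiv> (Gen_a, True)"
abbreviation "letter_b \<equiv> (Gen_b, True)"

definition quasidihedral :: "nat \<Rightarrow> qd_gen word set monoid" where
  "quasidihedral n = presented_group
    {replicate (2 ^ (n - 1)) letter_a,
     [letter_b, letter_b],
     [letter_b, letter_a, letter_b] @ replicate (2 ^ (n - 2) + 1) letter_a}"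


section \<open>Normalized right transversals\<close>

definition nrts :: "('a, 'b) monoid_scheme \<Rightarrow> 'a set \<Rightarrow> 'a set set" where
  "nrts G H = {S. S \<subseteq> carrier G \<and> \<one>\<^bsub>G\<^esub> \<in> S \<and> (\<forall>C \<in> rcosets\<^bsub>G\<^esub> H. \<exists>!x. x \<in> S \<inter> C)}"

text \<open>
  The right loop is packaged as a \<open>monoid\<close> record only to reuse the library's \<open>iso\<close> and \<open>\<cong>\<close>, which
  ask for no more than an operation-preserving bijection; the operation need not be associative.
\<close>

definition nrt_loop :: "('a, 'b) monoid_scheme \<Rightarrow> 'a set \<Rightarrow> 'a set \<Rightarrow> 'a monoid" where
  "nrt_loop G H S =
    \<lparr>carrier = S,
     mult = (\<lambda>x y. THE z. z \<in> S \<inter> (H #>\<^bsub>G\<^esub> (x \<otimes>\<^bsub>G\<^esub> y))),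
     one = \<one>\<^bsub>G\<^esub>\<rparr>"


section \<open>The transiso graph\<close>

text \<open>A simple graph is a pair of a vertex set and a set of two-element edges.\<close>

definition transiso_graph ::
    "('a, 'b) monoid_scheme \<Rightarrow> nat \<Rightarrow> 'a set set \<times> 'a set set set" where
  "transiso_graph G d =
    (let V = {H. subgroup H G \<and> card H = d}
     in (V, {{H\<^sub>1, H\<^sub>2} | H\<^sub>1 H\<^sub>2. H\<^sub>1 \<in> V \<and> H\<^sub>2 \<in> V \<and> H\<^sub>1 \<noteq> H\<^sub>2 \<and>
           (\<exists>S\<^sub>1 \<in> nrts G H\<^sub>1. \<exists>S\<^sub>2 \<in> nrts G H\<^sub>2. nrt_loop G H\<^sub>1 S\<^sub>1 \<cong> nrt_loop G H\<^sub>2 S\<^sub>2)}))"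

definition complete_graph :: "'v set \<times> 'v set set \<Rightarrow> bool" where
  "complete_graph \<Gamma> \<longleftrightarrow> (\<forall>x \<in> fst \<Gamma>. \<forall>y \<in> fst \<Gamma>. x \<noteq> y \<longrightarrow> {x, y} \<in> snd \<Gamma>)"

end

theory Submission
  imports Defs
begin

text \<open>
  Put \<open>p = 2 ^ (n - 4)\<close>, so that \<open>a\<close> has order \<open>8 p\<close> and \<open>b a b = a ^ (4 p - 1)\<close>.

  If \<open>4\<close> divides \<open>d\<close> and \<open>d l = 8 p\<close>, every subgroup of order \<open>d\<close> has an NRT whose right loop is
  the dihedral group of order \<open>2 l\<close>: the subgroup is either \<open>\<langle>a ^ l\<rangle>\<close>, which is normal with dihedral
  quotient, or \<open>\<langle>a ^ (2 l), a ^ t b\<rangle>\<close>, and modulo the normal subgroup \<open>\<langle>a ^ (2 l)\<rangle>\<close> the elements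
  \<open>a ^ (2 j)\<close> and \<open>a ^ (2 j + t + 1) b\<close> form a dihedral complement of it. Subgroups of order \<open>1\<close> and
  \<open>2 ^ n\<close> are unique.

  For \<open>d = 2\<close>, compare the centre \<open>Z\<close> with \<open>\<langle>b\<rangle>\<close>. All NRTs of \<open>Z\<close> are copies of the dihedral group
  \<open>G / Z\<close>. As \<open>\<langle>b\<rangle>\<close> is core-free, an NRT of it with associative operation is a subgroup of \<open>G\<close>
  complementing \<open>\<langle>b\<rangle>\<close>; it contains no conjugate of \<open>b\<close>, hence at most one involution, whereas \<open>G / Z\<close>
  has several.
\<close>

section \<open>Coordinates on the quasidihedral group\<close>

text \<open>Here \<open>q i e\<close> stands for \<open>a ^ i\<close> or \<open>a ^ i b\<close>, according to the flag \<open>e\<close>.\<close>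

locale qd_coordinates = group G for G :: "('a, 'b) monoid_scheme" (structure) +
  fixes q :: "int \<Rightarrow> bool \<Rightarrow> 'a" and p :: int
  assumes p_pos: "p > 0"
    and carrier_eq: "carrier G = range (case_prod q)"
    and q_mult: "q i e \<otimes> q j f = q (if e then i + (4 * p - 1) * j else i + j) (e \<noteq> f)"
    and q_eq_iff: "q i e = q j f \<longleftrightarrow> 8 * p dvd i - j \<and> e = f"

section \<open>Words acting on normal forms\<close>

text \<open>Left multiplication of \<open>a^i b^e\<close> by a letter, the exponent staying
  unreduced. For \<open>b\<close> the sign is ignored, as \<open>b\<close> is to be its own inverse.
  The action will show that distinct normal forms stay distinct in the presented group.\<close>

fun act :: "int \<Rightarrow> qd_gen \<times> bool \<Rightarrow> int \<times> bool \<Rightarrow> int \<times> bool" where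
  "act p (Gen_a, s) (i, e) = (if s then i + 1 else i - 1, e)"
| "act p (Gen_b, s) (i, e) = ((4 * p - 1) * i, \<not> e)"

definition same_point :: "int \<Rightarrow> int \<times> bool \<Rightarrow> int \<times> bool \<Rightarrow> bool" where
  "same_point p x y \<longleftrightarrow> 8 * p dvd fst x - fst y \<and> snd x = snd y"

lemma same_point_refl: "same_point p x x"
  by (simp add: same_point_def)

lemma same_point_sym: "same_point p x y \<Longrightarrow> same_point p y x"
  by (simp add: same_point_def dvd_diff_commute)

lemma same_point_trans: "same_point p x y \<Longrightarrow> same_point p y z \<Longrightarrow> same_point p x z"
  unfolding same_point_def using dvd_add[of "8 * p" "fst x - fst y" "fst y - fst z"] by simp

lemma same_point_act: "same_point p x y \<Longrightarrow> same_point p (act p l x) (act p l y)"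
  by (cases "(p, l, x)" rule: act.cases; cases y)
    (auto simp: same_point_def simp flip: right_diff_distrib)

lemma same_point_foldr:
  "same_point p x y \<Longrightarrow> same_point p (foldr (act p) u x) (foldr (act p) u y)"
  by (induction u) (simp_all add: same_point_act)

lemma funpow_act_a: "(act p letter_a ^^ k) (i, e) = (i + int k, e)"
  by (induction k) simp_all

definition qd_relators :: "nat \<Rightarrow> qd_gen word set" where
  "qd_relators p = {replicate (8 * p) letter_a, [letter_b, letter_b],
    [letter_b, letter_a, letter_b] @ replicate (4 * p + 1) letter_a}"

lemma same_point_relator:
  assumes "r \<in> qd_relators p"
  shows "same_point (int p) (foldr (act (int p)) r x) x"
proof -
  obtain i e where x: "x = (i, e)" by (cases x)
  let ?p = "int p"
  \<comment> \<open>The last letter of a word acts first. Both relators containing \<open>b\<close>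
    fix the exponent modulo \<open>8 * p\<close> because
    \<open>(4 * p - 1)^2 = 1 + 8 * p * (2 * p - 1)\<close>; the longer one also uses
    \<open>(4 * p + 1) + (4 * p - 1) = 8 * p\<close>.\<close>
  have "(4 * ?p - 1) * ((4 * ?p - 1) * i) - i = (8 * ?p) * ((2 * ?p - 1) * i)"
    "(4 * ?p - 1) * ((4 * ?p - 1) * (i + (4 * ?p + 1)) + 1) - i
      = (8 * ?p) * ((2 * ?p - 1) * (i + 4 * ?p + 1) + 1)"
    by (simp_all add: algebra_simps)
  then have "8 * ?p dvd (4 * ?p - 1) * ((4 * ?p - 1) * i) - i"
    "8 * ?p dvd (4 * ?p - 1) * ((4 * ?p - 1) * (i + (4 * ?p + 1)) + 1) - i"
    by (metis dvd_triv_left)+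
  then show ?thesis
    using assms unfolding qd_relators_def x
    by (auto simp: same_point_def funpow_act_a ac_simps)
qed

lemma same_point_word_eq:
  assumes "word_eq (qd_relators p) u v"
  shows "same_point (int p) (foldr (act (int p)) u x) (foldr (act (int p)) v x)"
  using assms
proof (induction arbitrary: x rule: word_eq.induct)
  case (cancel u g e v)
  \<comment> \<open>For \<open>b\<close> a cancelling pair acts exactly as the relator
    \<open>b b\<close>, since \<open>act\<close> ignores the sign there.\<close>
  have "same_point (int p) (foldr (act (int p)) [(g, e), (g, \<not> e)] y) y" for y
  proof (cases g)
    case Gen_a
    then show ?thesis by (cases y) (simp add: same_point_def)
  next
    case Gen_b
    then show ?thesis
      using same_point_relator[of "[letter_b, letter_b]" p y]
      by (cases y) (simp add: qd_relators_def)
  qed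
  then show ?case
    unfolding foldr_append comp_apply by (rule same_point_foldr)
next
  case (relator r u v)
  then show ?case
    unfolding foldr_append comp_apply by (intro same_point_foldr same_point_relator)
next
  case (sym u v)
  show ?case by (rule same_point_sym) (rule sym)
next
  case (trans u v w)
  then show ?case by (metis same_point_trans)
qed (rule same_point_refl)

section \<open>Normal forms in the presented group\<close>

text \<open>Conjugation by \<open>b\<close> is an endomorphism, so its value at \<open>a\<close>
  determines it on all powers of \<open>a\<close>, negative ones included.\<close>

lemma (in group) conj_int_pow:
  assumes "a \<in> carrier G" "b \<in> carrier G" "b \<otimes> a = a [^] (r::int) \<otimes> b"
  shows "b \<otimes> a [^] (j::int) = a [^] (r * j) \<otimes> b"
proof -
  let ?c = "\<lambda>x. b \<otimes> x \<otimes> inv b"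
  have "group_hom G G ?c"
    using assms(2) by unfold_locales (auto simp: hom_def m_assoc inv_solve_left)
  from group_hom.hom_int_pow[OF this assms(1), of j]
  have "?c (a [^] j) = ?c a [^] j" .
  also have "?c a = a [^] r"
    using assms by (simp add: m_assoc)
  finally have "?c (a [^] j) = a [^] (r * j)"
    using assms(1) by (simp add: int_pow_pow)
  then show ?thesis
    using assms(1,2) by (metis inv_solve_right int_pow_closed m_closed)
qed

text \<open>The relations move every \<open>b\<close> to the right, so each element is some
  \<open>q i e\<close>. Letting words act on \<open>(0, False)\<close> reads off the exponent modulo
  \<open>8 * p\<close> and the flag, which rules out further coincidences.\<close>

lemma presented_group_coordinates:
  assumes "p > 0"
  shows "\<exists>q. qd_coordinates (presented_group (qd_relators p)) q (int p)"
proof -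
  let ?R = "qd_relators p"
  let ?P = "presented_group ?R"
  interpret P: group ?P by (rule group_presented_group)
  define c where "c u = word_rel ?R `` {u}" for u
  have c_mult: "c u \<otimes>\<^bsub>?P\<^esub> c v = c (u @ v)" for u v
    unfolding c_def by (rule presented_group_mult)
  have c_eq: "c u = c v \<longleftrightarrow> word_eq ?R u v" for u v
    unfolding c_def by (rule word_class_eq_iff)
  have one: "\<one>\<^bsub>?P\<^esub> = c []" by (simp add: c_def presented_group_def)
  have c_in [simp]: "c u \<in> carrier ?P" for u
    by (simp add: c_def presented_group_def quotientI)
  have carrier: "carrier ?P = range c"
    by (auto simp: c_def presented_group_def elim!: quotientE intro: quotientI)
  have c_rel: "c r = \<one>\<^bsub>?P\<^esub>" if "r \<in> ?R" for r
    using word_eq.relator[OF that, of "[]" "[]"] by (simp add: one c_eq)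
  let ?a = "c [letter_a]" and ?b = "c [letter_b]"
  have pow_a: "?a [^]\<^bsub>?P\<^esub> k = c (replicate k letter_a)" for k :: nat
    by (induction k) (simp_all add: one c_mult replicate_append_same)
  have aN: "?a [^]\<^bsub>?P\<^esub> (8 * int p) = \<one>\<^bsub>?P\<^esub>"
  proof -
    have "?a [^]\<^bsub>?P\<^esub> (8 * p) = \<one>\<^bsub>?P\<^esub>"
      unfolding pow_a by (rule c_rel) (simp add: qd_relators_def)
    then show ?thesis by (metis int_pow_int of_nat_mult of_nat_numeral)
  qed
  have a_cong: "?a [^]\<^bsub>?P\<^esub> i = ?a [^]\<^bsub>?P\<^esub> j" if "8 * int p dvd i - j" for i j :: int
  proof -
    from that obtain k where "i = 8 * int p * k + j" by (metis diff_add_cancel dvd_def)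
    then show ?thesis
      by (simp only: P.int_pow_mult P.int_pow_pow[symmetric] aN c_in P.int_pow_one P.int_pow_closed
          P.l_one)
  qed
  have bb: "?b \<otimes>\<^bsub>?P\<^esub> ?b = \<one>\<^bsub>?P\<^esub>"
    unfolding c_mult by (rule c_rel) (simp add: qd_relators_def)
  have bab: "?b \<otimes>\<^bsub>?P\<^esub> ?a \<otimes>\<^bsub>?P\<^esub> ?b \<otimes>\<^bsub>?P\<^esub> ?a [^]\<^bsub>?P\<^esub> (4 * p + 1) = \<one>\<^bsub>?P\<^esub>"
    unfolding pow_a c_mult by (rule c_rel) (simp add: qd_relators_def)
  \<comment> \<open>\<open>b a b\<close> is inverse to \<open>a^(4 * p + 1)\<close>, and
    \<open>-(4 * p + 1)\<close> agrees with \<open>4 * p - 1\<close> modulo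
    \<open>8 * p\<close>.\<close>
  have ba: "?b \<otimes>\<^bsub>?P\<^esub> ?a = ?a [^]\<^bsub>?P\<^esub> (4 * int p - 1) \<otimes>\<^bsub>?P\<^esub> ?b"
  proof -
    have "?b \<otimes>\<^bsub>?P\<^esub> ?a \<otimes>\<^bsub>?P\<^esub> ?b = inv\<^bsub>?P\<^esub> (?a [^]\<^bsub>?P\<^esub> (4 * p + 1))"
      using bab by (intro P.inv_equality[symmetric]) simp_all
    also have "\<dots> = ?a [^]\<^bsub>?P\<^esub> (- int (4 * p + 1))"
      by (simp only: P.int_pow_neg c_in int_pow_int)
    also have "\<dots> = ?a [^]\<^bsub>?P\<^esub> (4 * int p - 1)"
      by (rule a_cong) simp
    finally have "?b \<otimes>\<^bsub>?P\<^esub> ?a \<otimes>\<^bsub>?P\<^esub> ?b \<otimes>\<^bsub>?P\<^esub> ?b = ?a [^]\<^bsub>?P\<^esub> (4 * int p - 1) \<otimes>\<^bsub>?P\<^esub> ?b"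
      by simp
    then show ?thesis by (simp add: P.m_assoc bb)
  qed
  define q where "q i e = ?a [^]\<^bsub>?P\<^esub> i \<otimes>\<^bsub>?P\<^esub> (if e then ?b else \<one>\<^bsub>?P\<^esub>)" for i :: int and e
  have q_in: "q i e \<in> carrier ?P" for i e by (simp add: q_def)
  have q_mult: "q i e \<otimes>\<^bsub>?P\<^esub> q j f = q (if e then i + (4 * int p - 1) * j else i + j) (e \<noteq> f)"
    for i j e f
  proof (cases e)
    case True
    have "q i e \<otimes>\<^bsub>?P\<^esub> q j f = ?a [^]\<^bsub>?P\<^esub> i \<otimes>\<^bsub>?P\<^esub> (?b \<otimes>\<^bsub>?P\<^esub> ?a [^]\<^bsub>?P\<^esub> j)
        \<otimes>\<^bsub>?P\<^esub> (if f then ?b else \<one>\<^bsub>?P\<^esub>)"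
      by (simp add: q_def True P.m_assoc)
    also have "\<dots> = q (i + (4 * int p - 1) * j) (\<not> f)"
      unfolding P.conj_int_pow[OF c_in c_in ba] by (simp add: q_def P.m_assoc P.int_pow_mult bb)
    finally show ?thesis using True by simp
  next
    case False
    then show ?thesis by (simp add: q_def P.m_assoc P.int_pow_mult)
  qed
  \<comment> \<open>A word spelling a power of \<open>a\<close> with positive letters needs a
    natural exponent, hence the reduction modulo \<open>8 * p\<close>.\<close>
  have q_word: "q i e = c (replicate (nat (i mod (8 * int p))) letter_a @ (if e then [letter_b] else []))"
    for i e
  proof -
    have "?a [^]\<^bsub>?P\<^esub> i = ?a [^]\<^bsub>?P\<^esub> int (nat (i mod (8 * int p)))"
      using assms by (intro a_cong) (simp add: minus_mod_eq_mult_div)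
    then show ?thesis unfolding q_def by (simp only: int_pow_int pow_a one) (simp add: c_mult)
  qed
  have q_eq: "q i e = q j f \<longleftrightarrow> 8 * int p dvd i - j \<and> e = f" for i j e f
  proof
    assume "q i e = q j f"
    then have "word_eq ?R (replicate (nat (i mod (8 * int p))) letter_a @ (if e then [letter_b] else []))
        (replicate (nat (j mod (8 * int p))) letter_a @ (if f then [letter_b] else []))"
      unfolding q_word c_eq .
    from same_point_word_eq[OF this, of "(0, False)"]
    have "8 * int p dvd i mod (8 * int p) - j mod (8 * int p) \<and> e = f"
      using assms by (auto simp: same_point_def funpow_act_a split: if_splits)
    then show "8 * int p dvd i - j \<and> e = f"
      by (simp add: mod_eq_dvd_iff[symmetric])
  qed (auto simp: q_def dest: a_cong)
  have "c u \<in> range (case_prod q)" for u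
  proof (induction u)
    case Nil
    have "c [] = q 0 False" by (simp add: q_def one)
    then show ?case by (metis case_prod_conv rangeI)
  next
    case (Cons l u)
    then obtain i e where u: "c u = q i e" by auto
    obtain j f where l: "c [l] = q j f"
    proof (cases l)
      case (Pair g s)
      have inverse: "c [(g, False)] \<otimes>\<^bsub>?P\<^esub> c [(g, True)] = \<one>\<^bsub>?P\<^esub>"
        using word_eq.cancel[of ?R "[]" g False "[]"] by (simp add: c_mult one c_eq)
      then have inv: "c [(g, False)] = inv\<^bsub>?P\<^esub> c [(g, True)]"
        by (metis P.inv_equality c_in)
      show ?thesis
      proof (cases g)
        case Gen_a
        have "c [l] = ?a [^]\<^bsub>?P\<^esub> (if s then 1 else - 1 :: int)"
          using Pair Gen_a inv by (simp add: P.int_pow_neg)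
        then show ?thesis by (intro that[of _ False]) (simp add: q_def)
      next
        case Gen_b
        have "inv\<^bsub>?P\<^esub> ?b = ?b" using bb by (intro P.inv_equality) simp_all
        then have "c [l] = ?b"
          using Pair Gen_b inv by (cases s) simp_all
        then show ?thesis by (intro that[of 0 True]) (simp add: q_def)
      qed
    qed
    have "c (l # u) = c [l] \<otimes>\<^bsub>?P\<^esub> c u" by (simp add: c_mult)
    then show ?case unfolding u l q_mult by auto
  qed
  then have "carrier ?P = range (case_prod q)"
    unfolding carrier using q_in carrier by auto
  then show ?thesis
    using assms by (intro exI[of _ q]) (unfold_locales, simp_all add: q_mult q_eq)
qed

lemma qd_coordinates_iso:
  assumes "group G" "G \<cong> K" "qd_coordinates K q p"
  shows "\<exists>q. qd_coordinates G q p"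
proof -
  interpret group G by fact
  interpret K: qd_coordinates K q p by fact
  from iso_sym[OF assms(2)] obtain \<phi> where phi: "\<phi> \<in> iso K G" by (auto simp: is_iso_def)
  then have inj: "inj_on \<phi> (carrier K)" and im: "\<phi> ` carrier K = carrier G"
    and hom: "\<phi> \<in> hom K G"
    by (auto simp: iso_def bij_betw_def)
  have q_in: "q i e \<in> carrier K" for i e
    unfolding K.carrier_eq by (metis case_prod_conv rangeI)
  have "qd_coordinates G (\<lambda>i e. \<phi> (q i e)) p"
  proof
    show "carrier G = range (\<lambda>(i, e). \<phi> (q i e))"
      unfolding im[symmetric] K.carrier_eq by auto
    show "\<phi> (q i e) \<otimes>\<^bsub>G\<^esub> \<phi> (q j f) = \<phi> (q (if e then i + (4 * p - 1) * j else i + j) (e \<noteq> f))"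
      for i e j f
      using hom_mult[OF hom q_in q_in] by (simp add: K.q_mult)
    show "\<phi> (q i e) = \<phi> (q j f) \<longleftrightarrow> 8 * p dvd i - j \<and> e = f" for i e j f
      using inj_on_eq_iff[OF inj q_in q_in] by (simp add: K.q_eq_iff)
  qed (rule K.p_pos)
  then show ?thesis by blast
qed

section \<open>Right loops of transversals\<close>

text \<open>Transversal loops need not be groups. Closure of \<open>L\<close> is enough: it keeps
  the product of two preimages inside the set on which \<open>f\<close> is injective.\<close>

lemma is_iso_sym_of_closed:
  assumes "L \<cong> M"
    and closed: "\<And>x y. x \<in> carrier L \<Longrightarrow> y \<in> carrier L \<Longrightarrow> x \<otimes>\<^bsub>L\<^esub> y \<in> carrier L"
  shows "M \<cong> L"
proof -
  from assms(1) obtain f where "f \<in> iso L M" by (auto simp: is_iso_def)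
  then have bij: "bij_betw f (carrier L) (carrier M)" and hom: "f \<in> hom L M"
    by (simp_all add: iso_def)
  let ?g = "inv_into (carrier L) f"
  have g: "?g y \<in> carrier L" "f (?g y) = y" if "y \<in> carrier M" for y
    using bij that by (simp_all add: bij_betw_def inv_into_into f_inv_into_f)
  have "?g (y \<otimes>\<^bsub>M\<^esub> z) = ?g y \<otimes>\<^bsub>L\<^esub> ?g z" if "y \<in> carrier M" "z \<in> carrier M" for y z
  proof -
    have "f (?g y \<otimes>\<^bsub>L\<^esub> ?g z) = y \<otimes>\<^bsub>M\<^esub> z"
      using hom_mult[OF hom] g that by simp
    then show ?thesis
      using bij closed g that by (metis bij_betw_inv_into_left)
  qed
  then have "?g \<in> iso M L"
    using bij_betw_inv_into[OF bij] g by (auto simp: iso_def hom_def)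
  then show ?thesis by (rule is_isoI)
qed

context group
begin

lemma mem_rcos_iff:
  assumes "subgroup H G" "x \<in> carrier G" "y \<in> carrier G"
  shows "x \<in> H #> y \<longleftrightarrow> H #> x = H #> y"
  using assms by (metis repr_independence repr_independenceD)

lemma nrts_ex1:
  assumes "S \<in> nrts G H" "x \<in> carrier G" "subgroup H G"
  shows "\<exists>!z. z \<in> S \<inter> (H #> x)"
  using assms rcosetsI[OF subgroup.subset, of H x] by (simp add: nrts_def)

lemma nrt_loop_mult_eqI:
  assumes "S \<in> nrts G H" "subgroup H G" "x \<in> S" "y \<in> S" "z \<in> S" "z \<in> H #> (x \<otimes> y)"
  shows "x \<otimes>\<^bsub>nrt_loop G H S\<^esub> y = z"
proof -
  have "x \<otimes> y \<in> carrier G" using assms by (auto simp: nrts_def)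
  from the1_equality[OF nrts_ex1[OF assms(1) this assms(2)], of z] show ?thesis
    using assms by (simp add: nrt_loop_def)
qed

lemma nrt_loop_mult:
  assumes "S \<in> nrts G H" "subgroup H G" "x \<in> S" "y \<in> S"
  shows "x \<otimes>\<^bsub>nrt_loop G H S\<^esub> y \<in> S" "x \<otimes>\<^bsub>nrt_loop G H S\<^esub> y \<in> H #> (x \<otimes> y)"
proof -
  have "x \<otimes> y \<in> carrier G" using assms by (auto simp: nrts_def)
  from theI'[OF nrts_ex1[OF assms(1) this assms(2)]]
  show "x \<otimes>\<^bsub>nrt_loop G H S\<^esub> y \<in> S" "x \<otimes>\<^bsub>nrt_loop G H S\<^esub> y \<in> H #> (x \<otimes> y)"
    by (simp_all add: nrt_loop_def)
qed

text \<open>Realizes an abstract loop \<open>L\<close> inside \<open>G\<close>: by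
  \<open>mult\<close>, the product of \<open>f x\<close> and \<open>f y\<close> lies in the coset
  represented by the image of their product in \<open>L\<close>, and that representative is by
  definition the loop product.\<close>

lemma transversal_of_map:
  assumes H: "subgroup H G"
    and f: "\<And>x. x \<in> carrier L \<Longrightarrow> f x \<in> carrier G"
    and e: "e \<in> carrier L" "f e = \<one>"
    and cover: "\<And>g. g \<in> carrier G \<Longrightarrow> \<exists>!x. x \<in> carrier L \<and> g \<in> H #> f x"
    and closed: "\<And>x y. x \<in> carrier L \<Longrightarrow> y \<in> carrier L \<Longrightarrow> x \<otimes>\<^bsub>L\<^esub> y \<in> carrier L"
    and mult: "\<And>x y. x \<in> carrier L \<Longrightarrow> y \<in> carrier L \<Longrightarrow> f x \<otimes> f y \<in> H #> f (x \<otimes>\<^bsub>L\<^esub> y)"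
  shows "f ` carrier L \<in> nrts G H" "f \<in> iso L (nrt_loop G H (f ` carrier L))"
proof -
  have inj: "inj_on f (carrier L)"
    using cover f rcos_self[OF _ H] by (intro inj_onI) metis
  show nrt: "f ` carrier L \<in> nrts G H"
    unfolding nrts_def
  proof (intro CollectI conjI ballI)
    fix C assume "C \<in> rcosets H"
    then obtain g where g: "g \<in> carrier G" and C: "C = H #> g"
      by (auto simp: RCOSETS_def)
    obtain x where x: "x \<in> carrier L" "g \<in> H #> f x"
      and unique: "\<And>y. y \<in> carrier L \<Longrightarrow> g \<in> H #> f y \<Longrightarrow> y = x"
      using cover[OF g] by blast
    show "\<exists>!z. z \<in> f ` carrier L \<inter> C"
    proof (intro ex1I[of _ "f x"] IntI imageI)
      show "f x \<in> C" using x f g H C by (simp add: mem_rcos_iff)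
      fix z assume "z \<in> f ` carrier L \<inter> C"
      then obtain y where y: "z = f y" "y \<in> carrier L" "f y \<in> H #> g"
        using C by auto
      then have "y = x" using unique f g H by (simp add: mem_rcos_iff)
      then show "z = f x" by (simp add: y)
    qed (rule x)
  qed (use f e in \<open>auto simp: image_iff intro!: bexI[of _ e]\<close>)
  have "f (x \<otimes>\<^bsub>L\<^esub> y) = f x \<otimes>\<^bsub>nrt_loop G H (f ` carrier L)\<^esub> f y"
    if "x \<in> carrier L" "y \<in> carrier L" for x y
    using that mult[OF that] f closed H
    by (intro nrt_loop_mult_eqI[OF nrt H, symmetric]) (simp_all add: mem_rcos_iff)
  then show "f \<in> iso L (nrt_loop G H (f ` carrier L))"
    using inj by (auto simp: iso_def hom_def bij_betw_def nrt_loop_def)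
qed

end

section \<open>Dihedral transversals\<close>

text \<open>The pair \<open>(i, e)\<close> stands for \<open>r^i s^e\<close> in the dihedral group
  of order \<open>2 * l\<close>; \<open>l = 1\<close> and \<open>l = 2\<close> give the group of
  order 2 and the Klein four-group.\<close>

definition dihedral_loop :: "int \<Rightarrow> (int \<times> bool) monoid" where
  "dihedral_loop l = \<lparr>carrier = {0..<l} \<times> UNIV,
    mult = (\<lambda>(i, e) (j, f). ((if e then i - j else i + j) mod l, e \<noteq> f)),
    one = (0, False)\<rparr>"

lemma dihedral_loop_closed:
  assumes "x \<in> carrier (dihedral_loop l)" "y \<in> carrier (dihedral_loop l)"
  shows "x \<otimes>\<^bsub>dihedral_loop l\<^esub> y \<in> carrier (dihedral_loop l)"
  using assms by (cases x; cases y) (simp add: dihedral_loop_def)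

context qd_coordinates
begin

lemma q_in [simp]: "q i e \<in> carrier G"
  unfolding carrier_eq by (metis case_prod_conv rangeI)

lemma carrierE:
  assumes "x \<in> carrier G"
  obtains i e where "x = q i e"
  using assms unfolding carrier_eq by auto

lemma one_eq: "\<one> = q 0 False"
proof -
  have "q 0 False \<otimes> q 0 False = q 0 False" by (simp add: q_mult)
  then show ?thesis by (metis l_cancel_one q_in)
qed

lemma inv_q: "inv (q i e) = q (if e then - ((4 * p - 1) * i) else - i) e"
proof (rule inv_equality)
  show "q (if e then - ((4 * p - 1) * i) else - i) e \<otimes> q i e = \<one>"
    by (simp add: q_mult one_eq)
qed simp_all

lemma q_rcos_iff:
  assumes "subgroup H G"
  shows "q i e \<in> H #> q j f \<longleftrightarrow> q (if e = f then i - j else i - (4 * p - 1) * j) (e \<noteq> f) \<in> H"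
proof -
  have "q i e \<in> H #> q j f \<longleftrightarrow> q i e \<otimes> inv (q j f) \<in> H"
    by (rule subgroup.rcos_module[OF assms is_group]) simp_all
  \<comment> \<open>If both flags are set, the exponent is \<open>i - (4 * p - 1)^2 * j\<close>, and
    \<open>(4 * p - 1)^2\<close> is 1 modulo \<open>8 * p\<close>.\<close>
  also have "q i e \<otimes> inv (q j f) = q (if e = f then i - j else i - (4 * p - 1) * j) (e \<noteq> f)"
    unfolding inv_q q_mult q_eq_iff
    by (auto simp: algebra_simps)
  finally show ?thesis .
qed

lemma q_eq_one_iff: "q i e = \<one> \<longleftrightarrow> 8 * p dvd i \<and> \<not> e"
  by (simp add: one_eq q_eq_iff)

text \<open>In \<open>cover\<close>, the residue of \<open>k\<close> modulo \<open>l\<close> and the flag \<open>f\<^sub>0\<close> are the dihedral coordinates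
  of the coset of \<open>q i e\<close>.\<close>

lemma dihedral_transversal:
  assumes H: "subgroup H G" and l: "l > 0"
    and F: "\<And>j f. F j f \<in> carrier G" "F 0 False = \<one>"
    and cover: "\<And>i e. \<exists>k f\<^sub>0. \<forall>j f. q i e \<in> H #> F j f \<longleftrightarrow> f = f\<^sub>0 \<and> l dvd k - j"
    and mult: "\<And>i e j f. F i e \<otimes> F j f \<in> H #> F (if e then i - j else i + j) (e \<noteq> f)"
  shows "\<exists>S \<in> nrts G H. dihedral_loop l \<cong> nrt_loop G H S"
proof -
  let ?L = "dihedral_loop l" and ?F = "case_prod F"
  have residue: "l dvd k - j mod l \<longleftrightarrow> l dvd k - j" for k j
    by (simp add: mod_eq_dvd_iff[symmetric])
  \<comment> \<open>Products in \<open>dihedral_loop l\<close> are reduced modulo \<open>l\<close>,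
    whereas \<open>mult\<close> is not; the reduction leaves the coset unchanged.\<close>
  have F_mod: "H #> F (j mod l) f = H #> F j f" for j f
  proof -
    obtain i e where F_q: "F j f = q i e" using carrierE F(1) by metis
    obtain k f\<^sub>0 where k: "\<And>j f. q i e \<in> H #> F j f \<longleftrightarrow> f = f\<^sub>0 \<and> l dvd k - j"
      using cover[of i e] by blast
    have "q i e \<in> H #> F j f" using rcos_self[OF _ H, of "q i e"] by (simp add: F_q)
    then have "f = f\<^sub>0 \<and> l dvd k - j" by (simp only: k)
    then have "q i e \<in> H #> F (j mod l) f" by (simp only: k residue)
    then show ?thesis using mem_rcos_iff[OF H F(1) F(1), of j f "j mod l" f] F_q by metis
  qed
  have "\<exists>!x. x \<in> carrier ?L \<and> g \<in> H #> ?F x" if g: "g \<in> carrier G" for g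
  proof -
    obtain i e where "g = q i e" using g by (rule carrierE)
    then obtain k f\<^sub>0 where k: "\<And>j f. g \<in> H #> F j f \<longleftrightarrow> f = f\<^sub>0 \<and> l dvd k - j"
      using cover[of i e] by blast
    have eq: "j = k mod l" if "0 \<le> j" "j < l" "l dvd k - j" for j
      using that by (metis mod_eq_dvd_iff mod_pos_pos_trivial)
    have "l dvd k - k mod l" by (simp add: residue)
    with eq show ?thesis
      using l by (intro ex1I[of _ "(k mod l, f\<^sub>0)"]) (auto simp: dihedral_loop_def k)
  qed
  moreover have "?F x \<otimes> ?F y \<in> H #> ?F (x \<otimes>\<^bsub>?L\<^esub> y)" for x y
    using mult by (cases x; cases y) (simp add: dihedral_loop_def F_mod)
  ultimately have "?F ` carrier ?L \<in> nrts G H" "?F \<in> iso ?L (nrt_loop G H (?F ` carrier ?L))"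
    using H F l dihedral_loop_closed
    by (intro transversal_of_map[of _ _ _ "(0, False)"]; force simp: dihedral_loop_def)+
  then show ?thesis by (auto intro: is_isoI)
qed

text \<open>Modulo a divisor of \<open>4 * p\<close> the factor \<open>4 * p - 1\<close> is
  \<open>-1\<close>: there \<open>b\<close> inverts \<open>a\<close>, and quasidihedral
  multiplication becomes dihedral.\<close>

lemma reflection_exponent:
  assumes "c dvd 4 * p"
  shows "c dvd x + (4 * p - 1) * j \<longleftrightarrow> c dvd x - j" "c dvd x - (4 * p - 1) * j \<longleftrightarrow> c dvd x + j"
proof -
  have c: "c dvd 4 * p * j" "c dvd - (4 * p * j)" using assms by simp_all
  show "c dvd x + (4 * p - 1) * j \<longleftrightarrow> c dvd x - j"
    using dvd_add_left_iff[OF c(1), of "x - j"] by (simp add: algebra_simps)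
  show "c dvd x - (4 * p - 1) * j \<longleftrightarrow> c dvd x + j"
    using dvd_add_left_iff[OF c(2), of "x + j"] by (simp add: algebra_simps)
qed

text \<open>The coordinates \<open>q\<close> themselves serve as representatives: modulo
  \<open>H\<close> exponents count modulo \<open>l\<close>, and \<open>b\<close> inverts
  \<open>a\<close>.\<close>

lemma cyclic_subgroup_transversal:
  assumes H: "subgroup H G" and mem: "\<And>i e. q i e \<in> H \<longleftrightarrow> \<not> e \<and> l dvd i"
    and l: "l > 0" "l dvd 4 * p"
  shows "\<exists>S \<in> nrts G H. dihedral_loop l \<cong> nrt_loop G H S"
proof (rule dihedral_transversal[OF H l(1), of q])
  show "\<exists>k f\<^sub>0. \<forall>j f. q i e \<in> H #> q j f \<longleftrightarrow> f = f\<^sub>0 \<and> l dvd k - j" for i e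
    by (intro exI[of _ i] exI[of _ e]) (auto simp: q_rcos_iff[OF H] mem)
  show "q i e \<otimes> q j f \<in> H #> q (if e then i - j else i + j) (e \<noteq> f)" for i e j f
    using l(2) by (simp add: q_mult q_rcos_iff[OF H] mem algebra_simps)
qed (simp_all add: one_eq)

text \<open>Modulo \<open>a^(2 * l)\<close> the map \<open>F\<close> is multiplicative. Its
  reflections have exponents of the parity opposite to \<open>t\<close>, while the reflections in
  \<open>H\<close> have the parity of \<open>t\<close>; this separates the cosets.\<close>

lemma noncyclic_subgroup_transversal:
  assumes H: "subgroup H G" and mem: "\<And>i e. q i e \<in> H \<longleftrightarrow> 2 * l dvd (if e then i - t else i)"
    and l: "l > 0" "2 * l dvd 4 * p"
  shows "\<exists>S \<in> nrts G H. dihedral_loop l \<cong> nrt_loop G H S"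
proof -
  have coset: "q i e \<in> H #> q j f \<longleftrightarrow> 2 * l dvd (if e = f then i - j else i - t + j)" for i e j f
    using reflection_exponent(2)[OF l(2), of "i - t" j]
    by (auto simp: q_rcos_iff[OF H] mem algebra_simps)
  have even: "2 * l dvd x \<longleftrightarrow> l dvd k" if "x = 2 * k \<or> x = - (2 * k)" for x k
    using that by auto
  have odd: "\<not> 2 * l dvd x" if "x = 2 * k + 1" for x k
    unfolding that by (metis dvd_mult_left even_plus_one_iff dvd_triv_left)
  define F where "F j f = q (2 * j + (if f then t + 1 else 0)) f" for j f
  show ?thesis
  proof (rule dihedral_transversal[OF H l(1), of F])
    show "\<exists>k f\<^sub>0. \<forall>j f. q i e \<in> H #> F j f \<longleftrightarrow> f = f\<^sub>0 \<and> l dvd k - j" for i e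
    proof -
      \<comment> \<open>The parity of \<open>s\<close> decides the flag of the representative: even
        for a rotation, odd for a reflection. Halving the remaining condition modulo
        \<open>2 * l\<close> gives one modulo \<open>l\<close>.\<close>
      define s where "s = (if e then i - t else i)"
      define k where "k = s div 2"
      have F_coset: "q i e \<in> H #> F j f \<longleftrightarrow>
          2 * l dvd s + (if e = f then - 2 * j - of_bool f else 2 * j + of_bool f)" for j f
        by (simp add: F_def coset s_def algebra_simps)
      show ?thesis
      proof (cases "even s")
        case True
        then have s: "s = 2 * k" by (simp add: k_def)
        have "\<not> q i e \<in> H #> F j True" for j
          unfolding F_coset by (rule odd[of _ "if e then k - j - 1 else k + j"]) (simp add: s)
        moreover have "q i e \<in> H #> F j False \<longleftrightarrow> l dvd (if e then - k else k) - j" for j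
          unfolding F_coset by (rule even) (simp add: s)
        ultimately show ?thesis by (metis (full_types))
      next
        case False
        then have s: "s = 2 * k + 1" by (simp add: k_def)
        have "\<not> q i e \<in> H #> F j False" for j
          unfolding F_coset by (rule odd[of _ "if e then k + j else k - j"]) (simp add: s)
        moreover have "q i e \<in> H #> F j True \<longleftrightarrow> l dvd (if e then k else - k - 1) - j" for j
          unfolding F_coset by (rule even) (simp add: s)
        ultimately show ?thesis by (metis (full_types))
      qed
    qed
    show "F i e \<otimes> F j f \<in> H #> F (if e then i - j else i + j) (e \<noteq> f)" for i e j f
    proof -
      have "2 * l dvd 4 * p * z" for z using l(2) by simp
      from this[of "2 * j + (if f then t + 1 else 0)"] show ?thesis
        by (auto simp: F_def q_mult coset algebra_simps)
    qed
  qed (simp_all add: F_def one_eq)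
qed

section \<open>Classification of the subgroups\<close>

text \<open>The exponents of rotations in \<open>H\<close> are the multiples of the least positive
  one, \<open>c\<close>. If \<open>H\<close> contains a reflection \<open>a^t b\<close>, its
  reflections are the translates of this one by the rotations.\<close>

lemma subgroup_cases:
  assumes H: "subgroup H G"
  obtains (cyclic) c where "c > 0" "\<And>i e. q i e \<in> H \<longleftrightarrow> \<not> e \<and> c dvd i" "int (card H) * c = 8 * p"
  | (noncyclic) c t where "c > 0" "\<And>i e. q i e \<in> H \<longleftrightarrow> c dvd (if e then i - t else i)"
      "int (card H) * c = 16 * p"
proof -
  let ?P = "\<lambda>k. k > 0 \<and> q (int k) False \<in> H"
  define c where "c = int (LEAST k. ?P k)"
  have "q (8 * p) False = \<one>" by (simp add: q_eq_one_iff)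
  \<comment> \<open>\<open>a^(8 * p) = 1\<close> supplies a positive exponent, so the
    \<open>LEAST\<close> is attained.\<close>
  then have "?P (nat (8 * p))" using p_pos subgroup.one_closed[OF H] by simp
  then have "?P (LEAST k. ?P k)" by (rule LeastI)
  then have c: "c > 0" "q c False \<in> H" by (simp_all add: c_def)
  have least: "c \<le> k" if "k > 0" "q k False \<in> H" for k
    using that Least_le[of ?P "nat k"] by (simp add: c_def)
  have add: "q (i + j) False \<in> H" if "q i False \<in> H" "q j False \<in> H" for i j
    using subgroup.m_closed[OF H that] by (simp add: q_mult)
  have neg: "q (- i) False \<in> H" if "q i False \<in> H" for i
    using subgroup.m_inv_closed[OF H that] by (simp add: inv_q)
  have multiple: "q (c * z) False \<in> H" for z
  proof (induction z rule: int_induct[of _ 0])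
    case base
    then show ?case using subgroup.one_closed[OF H] by (simp add: one_eq)
  next
    case (step1 i)
    then show ?case using add[of "c * i" c] c by (simp add: algebra_simps)
  next
    case (step2 i)
    then show ?case using add[of "c * i" "- c"] neg c by (simp add: algebra_simps)
  qed
  have mem_rotation: "q i False \<in> H \<longleftrightarrow> c dvd i" for i
  proof
    assume "q i False \<in> H"
    then have "q (i + c * (- (i div c))) False \<in> H" using add multiple by blast
    then have "q (i mod c) False \<in> H" by (simp add: minus_mult_div_eq_mod)
    then have "i mod c = 0"
      using least[of "i mod c"] pos_mod_bound[OF c(1), of i] pos_mod_sign[OF c(1), of i] by linarith
    then show "c dvd i" by (simp add: dvd_eq_mod_eq_0)
  qed (use multiple in \<open>auto simp: dvd_def\<close>)
  then have "c dvd 8 * p" using \<open>q (8 * p) False = \<one>\<close> subgroup.one_closed[OF H] by metis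
  then obtain k where k: "8 * p = c * k" ..
  then have "k > 0" using p_pos c(1) by (intro zero_less_mult_pos[of c k]) simp_all
  have q_eq: "q i e = q j f \<longleftrightarrow> c * k dvd i - j \<and> e = f" for i e j f
    by (simp only: q_eq_iff k)
  \<comment> \<open>Counts both cases at once: \<open>E\<close> is the set of flags occurring in
    \<open>H\<close>, and each flag occurs with \<open>k\<close> exponents modulo
    \<open>8 * p\<close>.\<close>
  have card: "int (card H) = k * int (card E)"
    if mem: "\<And>i e. q i e \<in> H \<longleftrightarrow> e \<in> E \<and> c dvd (if e then i - t else i)" for E t
  proof -
    let ?f = "\<lambda>(i, e). q (c * i + (if e then t else 0)) e"
    have inj: "inj_on ?f ({0..<k} \<times> E)"
    proof (rule inj_onI, clarify)
      fix i e j f assume ij: "i \<in> {0..<k}" "j \<in> {0..<k}"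
        and "q (c * i + (if e then t else 0)) e = q (c * j + (if f then t else 0)) f"
      then have "c * k dvd c * (i - j)" and e: "e = f"
        by (auto simp: q_eq right_diff_distrib)
      then have "k dvd i - j" using c(1) by simp
      then have "i mod k = j mod k" by (simp add: mod_eq_dvd_iff)
      then show "i = j \<and> e = f" using ij e by simp
    qed
    have image: "?f ` ({0..<k} \<times> E) = H"
    proof
      show "?f ` ({0..<k} \<times> E) \<subseteq> H" by (auto simp: mem)
      show "H \<subseteq> ?f ` ({0..<k} \<times> E)"
      proof
        fix x assume x: "x \<in> H"
        then obtain i e where q: "x = q i e"
          using carrierE subgroup.mem_carrier[OF H] by metis
        then obtain z where z: "i = c * z + (if e then t else 0)" and e: "e \<in> E"
          using x mem[of i e] by (auto simp: dvd_def algebra_simps split: if_splits)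
        have "c * k dvd c * (z - z mod k)" by (intro mult_dvd_mono) simp_all
        then have "x = ?f (z mod k, e)"
          by (simp add: q z q_eq right_diff_distrib)
        then show "x \<in> ?f ` ({0..<k} \<times> E)"
          using e \<open>k > 0\<close> by (intro image_eqI[of _ _ "(z mod k, e)"]) simp_all
      qed
    qed
    have "card H = card ({0..<k} \<times> E)" using card_image[OF inj] unfolding image .
    then show ?thesis using \<open>k > 0\<close> by (simp add: card_cartesian_product)
  qed
  show thesis
  proof (cases "\<exists>t. q t True \<in> H")
    case False
    then have mem: "q i e \<in> H \<longleftrightarrow> \<not> e \<and> c dvd i" for i e
      using mem_rotation by (cases e) auto
    have "int (card H) = k" using card[of "{False}" 0] by (simp add: mem)
    then show thesis using c(1) mem k by (intro cyclic[of c]) (simp_all add: mult.commute)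
  next
    case True
    then obtain t where t: "q t True \<in> H" ..
    have "H #> q t True = H" using t H by (intro coset_join2) simp_all
    then have "q i True \<in> H \<longleftrightarrow> c dvd i - t" for i
      using q_rcos_iff[OF H, of i True t True] mem_rotation by simp
    then have mem: "q i e \<in> H \<longleftrightarrow> c dvd (if e then i - t else i)" for i e
      using mem_rotation by simp
    have "int (card H) = k * 2" using card[of UNIV t] by (simp add: mem)
    then show thesis using c(1) mem k by (intro noncyclic[of c t]) (simp_all add: mult.commute)
  qed
qed

text \<open>Comparing orders gives \<open>c = l\<close> or \<open>c = 2 * l\<close>. Divisibility of
  the order by 4 makes \<open>l\<close> a divisor of \<open>2 * p\<close>, as the two constructions
  require.\<close>

lemma exists_dihedral_transversal:
  assumes H: "subgroup H G" and card: "4 dvd card H" "int (card H) * l = 8 * p"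
  shows "\<exists>S \<in> nrts G H. dihedral_loop l \<cong> nrt_loop G H S"
proof -
  from card obtain k where k: "card H = 4 * k" by blast
  with card p_pos have kl: "int k * l = 2 * p" and "k > 0"
    by (auto intro: gr0I simp: mult.commute)
  then have l: "l > 0" using p_pos
    by (metis mult_pos_pos of_nat_0_less_iff zero_less_mult_pos zero_less_numeral)
  from H show ?thesis
  proof (cases rule: subgroup_cases)
    case (cyclic c)
    then have "int (card H) * c = int (card H) * l" using card by linarith
    then have "c = l" using k \<open>k > 0\<close> by simp
    moreover have "4 * p = l * (2 * int k)" using kl by (simp add: mult.commute)
    ultimately show ?thesis
      using cyclic_subgroup_transversal[OF H cyclic(2)[unfolded \<open>c = l\<close>] l] by (metis dvd_triv_left)
  next
    case (noncyclic c t)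
    then have "int (card H) * c = int (card H) * (2 * l)" using card by linarith
    then have c: "c = 2 * l" using k \<open>k > 0\<close> by simp
    have "4 * p = 2 * l * int k" using kl by (simp add: mult.commute)
    then show ?thesis
      using noncyclic_subgroup_transversal[OF H noncyclic(2)[unfolded c] l] by (metis dvd_triv_left)
  qed
qed

end

section \<open>Core-free and normal subgroups\<close>

lemma (in group) nrts_eqI:
  assumes "S \<in> nrts G H" "subgroup H G" "x \<in> S" "y \<in> S" "H #> x = H #> y"
  shows "x = y"
proof -
  have "x \<in> carrier G" "y \<in> carrier G" using assms by (auto simp: nrts_def)
  then show ?thesis
    using nrts_ex1[OF assms(1) _ assms(2), of x] rcos_self[OF _ assms(2)] assms(3-5) by blast
qed

lemma (in group) rcos_nrt_loop_mult:
  assumes "S \<in> nrts G H" "subgroup H G" "x \<in> S" "y \<in> S"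
  shows "H #> (x \<otimes>\<^bsub>nrt_loop G H S\<^esub> y) = H #> (x \<otimes> y)"
proof -
  have "S \<subseteq> carrier G" using assms(1) by (simp add: nrts_def)
  then show ?thesis
    using nrt_loop_mult[OF assms] assms by (subst mem_rcos_iff[symmetric]) auto
qed

text \<open>Sending an element to its coset turns the loop operation into multiplication of cosets,
  which is associative, and it is injective on \<open>S\<close>.\<close>

lemma (in normal) nrt_loop_assoc:
  assumes S: "S \<in> nrts G H" and xyz: "x \<in> S" "y \<in> S" "z \<in> S"
  shows "x \<otimes>\<^bsub>nrt_loop G H S\<^esub> y \<otimes>\<^bsub>nrt_loop G H S\<^esub> z =
    x \<otimes>\<^bsub>nrt_loop G H S\<^esub> (y \<otimes>\<^bsub>nrt_loop G H S\<^esub> z)"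
proof (rule nrts_eqI[OF S is_subgroup])
  let ?L = "nrt_loop G H S"
  have carrier: "x \<in> carrier G" "y \<in> carrier G" "z \<in> carrier G"
    using S xyz by (auto simp: nrts_def)
  have sub: "S \<subseteq> carrier G" using S by (simp add: nrts_def)
  have step: "H #> (u \<otimes>\<^bsub>?L\<^esub> v) = (H #> u) <#> (H #> v)" if "u \<in> S" "v \<in> S" for u v
    using rcos_nrt_loop_mult[OF S is_subgroup that] rcos_sum[of u v] that sub by auto
  note closed = nrt_loop_mult(1)[OF S is_subgroup]
  show "x \<otimes>\<^bsub>?L\<^esub> y \<otimes>\<^bsub>?L\<^esub> z \<in> S" "x \<otimes>\<^bsub>?L\<^esub> (y \<otimes>\<^bsub>?L\<^esub> z) \<in> S"
    using closed xyz by simp_all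
  show "H #> (x \<otimes>\<^bsub>?L\<^esub> y \<otimes>\<^bsub>?L\<^esub> z) = H #> (x \<otimes>\<^bsub>?L\<^esub> (y \<otimes>\<^bsub>?L\<^esub> z))"
    using closed xyz carrier by (simp add: step rcos_sum m_assoc)
qed

text \<open>By associativity, \<open>x \<circ> y\<close> and \<open>x y\<close> act in the same way on the right cosets of \<open>H\<close>, and
  this action is faithful.\<close>

lemma (in group) nrt_loop_mult_of_core_free:
  assumes H: "subgroup H G"
    and core: "\<And>u. u \<in> H \<Longrightarrow> (\<And>g. g \<in> carrier G \<Longrightarrow> g \<otimes> u \<otimes> inv g \<in> H) \<Longrightarrow> u = \<one>"
    and S: "S \<in> nrts G H"
    and assoc: "\<And>x y z. x \<in> S \<Longrightarrow> y \<in> S \<Longrightarrow> z \<in> S \<Longrightarrow>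
      x \<otimes>\<^bsub>nrt_loop G H S\<^esub> y \<otimes>\<^bsub>nrt_loop G H S\<^esub> z =
      x \<otimes>\<^bsub>nrt_loop G H S\<^esub> (y \<otimes>\<^bsub>nrt_loop G H S\<^esub> z)"
    and xy: "x \<in> S" "y \<in> S"
  shows "x \<otimes>\<^bsub>nrt_loop G H S\<^esub> y = x \<otimes> y"
proof -
  let ?L = "nrt_loop G H S"
  have sub: "u \<in> carrier G" if "u \<in> S" for u using that S by (auto simp: nrts_def)
  note HS = subgroup.subset[OF H]
  note closed = nrt_loop_mult(1)[OF S H] and rcos = rcos_nrt_loop_mult[OF S H]
  define z where "z = x \<otimes>\<^bsub>?L\<^esub> y"
  \<comment> \<open>The discrepancy between the two products; all its conjugates turn out to lie in
    \<open>H\<close>.\<close>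
  define u where "u = z \<otimes> inv (x \<otimes> y)"
  have z: "z \<in> S" unfolding z_def using xy by (rule closed)
  then have u: "u \<in> carrier G" using xy by (simp add: u_def sub)
  \<comment> \<open>By associativity \<open>w z\<close> and \<open>w x y\<close> lie in the same
    right coset of \<open>H\<close>, and their quotient is this conjugate.\<close>
  have conj_S: "w \<otimes> u \<otimes> inv w \<in> H" if w: "w \<in> S" for w
  proof -
    have "H #> (w \<otimes> z) = H #> (w \<otimes>\<^bsub>?L\<^esub> x \<otimes>\<^bsub>?L\<^esub> y)"
      using rcos[OF w z] by (simp add: z_def assoc w xy)
    also have "\<dots> = H #> (w \<otimes>\<^bsub>?L\<^esub> x) #> y"
      using rcos[OF closed[OF w xy(1)] xy(2)] closed[OF w xy(1)] xy
      by (simp add: coset_mult_assoc HS sub)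
    also have "\<dots> = H #> (w \<otimes> (x \<otimes> y))"
      using rcos[OF w xy(1)] w xy by (simp add: coset_mult_assoc HS sub m_assoc)
    finally have "w \<otimes> z \<in> H #> (w \<otimes> (x \<otimes> y))"
      using H w xy z by (simp add: mem_rcos_iff sub)
    then have "w \<otimes> z \<otimes> inv (w \<otimes> (x \<otimes> y)) \<in> H"
      using subgroup.rcos_module[OF H is_group, of "w \<otimes> (x \<otimes> y)" "w \<otimes> z"] w xy z
      by (simp add: sub)
    then show ?thesis
      using w xy z by (simp add: u_def inv_mult_group m_assoc sub)
  qed
  \<comment> \<open>Every \<open>g\<close> is \<open>h w\<close> with \<open>h\<close> in
    \<open>H\<close> and \<open>w\<close> in \<open>S\<close>, so conjugation by elements of
    \<open>S\<close> suffices.\<close>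
  have conj: "g \<otimes> u \<otimes> inv g \<in> H" if g: "g \<in> carrier G" for g
  proof -
    obtain w where w: "w \<in> S" "w \<in> H #> g" using nrts_ex1[OF S g H] by blast
    then have "g \<in> H #> w" using mem_rcos_iff[OF H] g sub by metis
    then obtain h where h: "h \<in> H" "g = h \<otimes> w" by (auto simp: r_coset_def)
    then have "h \<otimes> (w \<otimes> u \<otimes> inv w) \<otimes> inv h \<in> H"
      using conj_S[OF w(1)] H by (simp add: subgroup.m_closed subgroup.m_inv_closed)
    then show ?thesis
      using h w u HS by (simp add: m_assoc inv_mult_group sub subsetD)
  qed
  then have "u = \<one>" using core[of u] conj[OF one_closed] u by simp
  then have "z = x \<otimes> y" using xy z inv_solve_right'[of \<one> z "x \<otimes> y"]
    by (simp add: u_def sub)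
  then show ?thesis by (simp add: z_def)
qed

text \<open>Edges are unordered, while the condition on \<open>H\<close> and \<open>K\<close> is
  stated in one order; its symmetry comes from \<open>is_iso_sym_of_closed\<close>.\<close>

lemma (in group) complete_transiso_graph_iff:
  "complete_graph (transiso_graph G d) \<longleftrightarrow>
    (\<forall>H K. subgroup H G \<and> card H = d \<and> subgroup K G \<and> card K = d \<and> H \<noteq> K \<longrightarrow>
      (\<exists>S \<in> nrts G H. \<exists>T \<in> nrts G K. nrt_loop G H S \<cong> nrt_loop G K T))"
proof -
  define adj where "adj H K \<longleftrightarrow> (\<exists>S \<in> nrts G H. \<exists>T \<in> nrts G K. nrt_loop G H S \<cong> nrt_loop G K T)"
    for H K
  have "nrt_loop G K T \<cong> nrt_loop G H S"
    if "nrt_loop G H S \<cong> nrt_loop G K T" "S \<in> nrts G H" "subgroup H G" for H K S T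
    using that(1)
  proof (rule is_iso_sym_of_closed)
    show "x \<otimes>\<^bsub>nrt_loop G H S\<^esub> y \<in> carrier (nrt_loop G H S)"
      if "x \<in> carrier (nrt_loop G H S)" "y \<in> carrier (nrt_loop G H S)" for x y
      using nrt_loop_mult(1)[OF \<open>S \<in> nrts G H\<close> \<open>subgroup H G\<close>, of x y] that
      by (simp add: nrt_loop_def)
  qed
  then have sym: "adj K H" if "adj H K" "subgroup H G" for H K
    using that unfolding adj_def by blast
  define V where "V = {H. subgroup H G \<and> card H = d}"
  define E where "E = {{H, K} |H K. H \<in> V \<and> K \<in> V \<and> H \<noteq> K \<and> adj H K}"
  have edge: "{H, K} \<in> E \<longleftrightarrow> adj H K" if "H \<in> V" "K \<in> V" "H \<noteq> K" for H K
  proof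
    assume "{H, K} \<in> E"
    then obtain H' K' where "{H, K} = {H', K'}" "H' \<in> V" "adj H' K'"
      unfolding E_def by (elim CollectE exE conjE) (rule that)
    moreover from this have "adj K' H'" using sym by (simp add: V_def)
    ultimately show "adj H K" by (auto simp: doubleton_eq_iff)
  next
    assume "adj H K"
    with that show "{H, K} \<in> E" unfolding E_def by (intro CollectI exI[of _ H] exI[of _ K]) simp
  qed
  have "transiso_graph G d = (V, E)"
    by (simp add: transiso_graph_def Let_def adj_def E_def V_def)
  then have "complete_graph (transiso_graph G d) \<longleftrightarrow> (\<forall>H \<in> V. \<forall>K \<in> V. H \<noteq> K \<longrightarrow> adj H K)"
    using edge by (simp add: complete_graph_def)
  then show ?thesis unfolding adj_def[symmetric] unfolding V_def by blast
qed

lemma (in group) subgroup_of_involution: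
  assumes "x \<in> carrier G" "x \<otimes> x = \<one>"
  shows "subgroup {\<one>, x} G"
  using assms by (intro subgroupI) (auto simp: inv_equality)

section \<open>The case \<open>d = 2\<close>: the centre against a noncentral reflection\<close>

context qd_coordinates
begin

text \<open>\<open>(4 * p - 1) * (4 * p)\<close> is \<open>4 * p\<close> modulo
  \<open>8 * p\<close>, so \<open>a^(4 * p)\<close> commutes with everything.\<close>

lemma normal_center: "{\<one>, q (4 * p) False} \<lhd> G"
proof -
  have "subgroup {\<one>, q (4 * p) False} G"
    by (rule subgroup_of_involution) (simp_all add: q_mult one_eq q_eq_iff)
  moreover have "x \<otimes> h \<otimes> inv x \<in> {\<one>, q (4 * p) False}"
    if x: "x \<in> carrier G" and h: "h \<in> {\<one>, q (4 * p) False}" for x h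
  proof -
    obtain i e where i: "x = q i e" using x by (rule carrierE)
    have "x \<otimes> q (4 * p) False = q (4 * p) False \<otimes> x"
      unfolding i by (auto simp: q_mult q_eq_iff algebra_simps)
    then have "x \<otimes> h = h \<otimes> x" using h x by auto
    then show ?thesis using h x by (auto simp: m_assoc)
  qed
  ultimately show ?thesis by (simp add: normal_inv_iff)
qed

lemma subgroup_reflection: "subgroup {\<one>, q 0 True} G"
  by (rule subgroup_of_involution) (simp_all add: q_mult one_eq)

text \<open>A single conjugate suffices: \<open>a b a^(-1) = a^(2 - 4 * p) b\<close>, which differs
  from \<open>b\<close>.\<close>

lemma reflection_core_free:
  assumes "u \<in> {\<one>, q 0 True}" "\<And>g. g \<in> carrier G \<Longrightarrow> g \<otimes> u \<otimes> inv g \<in> {\<one>, q 0 True}"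
  shows "u = \<one>"
proof (rule ccontr)
  assume "u \<noteq> \<one>"
  with assms have "q 1 False \<otimes> q 0 True \<otimes> inv (q 1 False) \<in> {\<one>, q 0 True}"
    by (metis insertE q_in singletonD)
  then have "8 * p dvd 4 * p - 2"
    by (auto simp: inv_q q_mult q_eq_one_iff q_eq_iff dvd_diff_commute)
  then show False using p_pos zdvd_imp_le[of "8 * p" "4 * p - 2"] by simp
qed

text \<open>The square of \<open>a^i b\<close> is \<open>a^(4 * p * i)\<close>, trivial exactly for
  even \<open>i\<close>; the square of \<open>a^i\<close> is trivial exactly when
  \<open>4 * p\<close> divides \<open>i\<close>.\<close>

lemma involution_cases:
  assumes "u \<in> carrier G" "u \<otimes> u = \<one>" "u \<noteq> \<one>" "u \<noteq> q (4 * p) False"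
  obtains i where "u = q (2 * i) True"
proof -
  obtain i e where u: "u = q i e" using assms(1) by (rule carrierE)
  show thesis
  proof (cases e)
    case True
    then have "2 * (4 * p) dvd i * (4 * p)"
      using assms(2) by (simp add: u q_mult q_eq_one_iff algebra_simps)
    then have "2 dvd i" using p_pos by (subst (asm) dvd_mult_cancel_right) simp
    then show thesis using that u True by (auto elim: evenE)
  next
    case False
    then have "2 * (4 * p) dvd 2 * i"
      using assms(2) by (simp add: u q_mult q_eq_one_iff)
    then have "4 * p dvd i" by (subst (asm) dvd_mult_cancel_left) simp
    then obtain k where k: "i = 4 * p * k" ..
    have "8 * p dvd i \<or> 8 * p dvd i - 4 * p"
    proof (cases "even k")
      case True
      then show ?thesis by (auto simp: k elim: evenE)
    next
      case odd: False
      then obtain j where "k = 2 * j + 1" by (rule oddE)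
      then have "i - 4 * p = 8 * p * j" by (simp add: k algebra_simps)
      then show ?thesis by (metis dvd_triv_left)
    qed
    then show thesis
      using assms(3,4) False by (auto simp: u q_eq_iff q_eq_one_iff)
  qed
qed

text \<open>The reflection \<open>t = q (2 * i) True\<close> is conjugate to \<open>b = q 0 True\<close>, and the set of all
  \<open>g\<close> with \<open>g t = b g\<close> is invariant under left multiplication by \<open>b\<close>, so it meets \<open>S\<close>; but then
  \<open>g\<close> and \<open>g t = b g\<close> are two elements of \<open>S\<close> in one coset.\<close>

lemma reflection_notin_closed_nrt:
  assumes S: "S \<in> nrts G {\<one>, q 0 True}"
    and closed: "\<And>x y. x \<in> S \<Longrightarrow> y \<in> S \<Longrightarrow> x \<otimes> y \<in> S"
  shows "q (2 * i) True \<notin> S"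
proof
  let ?b = "q 0 True"
  assume t: "q (2 * i) True \<in> S"
  \<comment> \<open>The conjugation equation asks for \<open>(4 * p - 2) * k\<close> to be
    \<open>2 * i\<close> modulo \<open>8 * p\<close>; this \<open>k\<close> solves it because
    \<open>(2 * p - 1) * (2 * p + 1) = 4 * p^2 - 1\<close>.\<close>
  define k where "k = - ((2 * p + 1) * i)"
  have "8 * p dvd (k + 2 * i) - (4 * p - 1) * k"
  proof -
    have "(k + 2 * i) - (4 * p - 1) * k = 8 * p * (p * i)"
      by (simp add: k_def algebra_simps)
    then show ?thesis by (metis dvd_triv_left)
  qed
  then have conj: "q k False \<otimes> q (2 * i) True = ?b \<otimes> q k False"
    by (simp add: q_mult q_eq_iff)
  obtain g where g: "g \<in> S" "g \<in> {\<one>, ?b} #> q k False"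
    using nrts_ex1[OF S q_in subgroup_reflection] by blast
  have bb: "?b \<otimes> ?b = \<one>" by (simp add: q_mult one_eq)
  from g(2) have "g = q k False \<or> g = ?b \<otimes> q k False" by (auto simp: r_coset_def)
  then have "g \<otimes> q (2 * i) True = ?b \<otimes> g"
    using conj by (auto simp: m_assoc)
  then have bg: "?b \<otimes> g \<in> S" using closed[OF g(1) t] by simp
  have g_in: "g \<in> carrier G" using g(1) S by (auto simp: nrts_def)
  have "?b \<otimes> g \<in> {\<one>, ?b} #> g" by (auto simp: r_coset_def)
  then have "{\<one>, ?b} #> (?b \<otimes> g) = {\<one>, ?b} #> g"
    using mem_rcos_iff[OF subgroup_reflection m_closed[OF q_in g_in] g_in] by simp
  then have "?b \<otimes> g = g" using nrts_eqI[OF S subgroup_reflection bg g(1)] by simp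
  then have "?b = \<one>" using g_in by simp
  then show False by (simp add: q_eq_one_iff)
qed

text \<open>An isomorphism would make \<open>S\<close> closed under the product of \<open>G\<close>,
  leaving \<open>q (4 * p) False\<close> as its only possible involution, while two distinct
  elements of \<open>T\<close> are sent to involutions.\<close>

lemma reflection_center_not_iso:
  assumes S: "S \<in> nrts G {\<one>, q 0 True}" and T: "T \<in> nrts G {\<one>, q (4 * p) False}"
  shows "\<not> nrt_loop G {\<one>, q (4 * p) False} T \<cong> nrt_loop G {\<one>, q 0 True} S"
proof
  let ?H = "{\<one>, q 0 True}" and ?Z = "{\<one>, q (4 * p) False}"
  let ?L = "nrt_loop G ?H S" and ?M = "nrt_loop G ?Z T"
  assume "?M \<cong> ?L"
  then obtain \<phi> where phi: "\<phi> \<in> iso ?M ?L" by (auto simp: is_iso_def)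
  interpret Z: normal ?Z G by (rule normal_center)
  have carrier: "carrier ?M = T" "carrier ?L = S" by (simp_all add: nrt_loop_def)
  from phi have inj: "inj_on \<phi> T" and im: "\<phi> ` T = S"
    and hom: "\<And>x y. x \<in> T \<Longrightarrow> y \<in> T \<Longrightarrow> \<phi> (x \<otimes>\<^bsub>?M\<^esub> y) = \<phi> x \<otimes>\<^bsub>?L\<^esub> \<phi> y"
    by (auto simp: iso_def bij_betw_def hom_def carrier)
  note closed_M = nrt_loop_mult(1)[OF T Z.is_subgroup]
  have assoc: "x \<otimes>\<^bsub>?L\<^esub> y \<otimes>\<^bsub>?L\<^esub> z = x \<otimes>\<^bsub>?L\<^esub> (y \<otimes>\<^bsub>?L\<^esub> z)" if "x \<in> S" "y \<in> S" "z \<in> S" for x y z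
  proof -
    from that im obtain x' y' z' where "x = \<phi> x'" "y = \<phi> y'" "z = \<phi> z'"
      and "x' \<in> T" "y' \<in> T" "z' \<in> T" by blast
    then show ?thesis
      using Z.nrt_loop_assoc[OF T, of x' y' z'] by (simp add: hom[symmetric] closed_M)
  qed
  have mult: "x \<otimes>\<^bsub>?L\<^esub> y = x \<otimes> y" if "x \<in> S" "y \<in> S" for x y
    using subgroup_reflection reflection_core_free S assoc that by (rule nrt_loop_mult_of_core_free)
  have closed: "x \<otimes> y \<in> S" if "x \<in> S" "y \<in> S" for x y
    using nrt_loop_mult(1)[OF S subgroup_reflection that] mult[OF that] by simp
  have S_in: "x \<in> carrier G" if "x \<in> S" for x using that S by (auto simp: nrts_def)
  have T_in: "x \<in> carrier G" if "x \<in> T" for x using that T by (auto simp: nrts_def)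
  have one_T: "\<one> \<in> T" using T by (simp add: nrts_def)
  have square: "x \<otimes>\<^bsub>?M\<^esub> x = \<one>" if "x \<in> T" "x \<otimes> x \<in> ?Z" for x
  proof (rule nrt_loop_mult_eqI[OF T Z.is_subgroup that(1,1) one_T])
    have "?Z #> (x \<otimes> x) = ?Z #> \<one>"
      using that(2) coset_join2[OF _ Z.is_subgroup that(2)] T_in[OF that(1)]
      by (simp add: Z.subset)
    then show "\<one> \<in> ?Z #> (x \<otimes> x)"
      using T_in[OF that(1)] by (simp add: mem_rcos_iff[OF Z.is_subgroup])
  qed
  have "\<phi> \<one> \<otimes> \<phi> \<one> = \<phi> \<one>"
    using hom[OF one_T one_T] square[OF one_T] mult im one_T by force
  then have phi_one: "\<phi> \<one> = \<one>"
    using S_in im one_T by (metis imageI l_cancel_one)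
  have involution: "\<phi> x \<in> S" "\<phi> x = q (4 * p) False"
    if x: "x \<in> T" "x \<otimes> x \<in> ?Z" "x \<noteq> \<one>" for x
  proof -
    show x_S: "\<phi> x \<in> S" using im x by blast
    have "\<phi> x \<otimes> \<phi> x = \<one>"
      using hom[OF x(1,1)] square[OF x(1,2)] mult[OF x_S x_S] phi_one by simp
    moreover have "\<phi> x \<noteq> \<one>" using inj_on_eq_iff[OF inj x(1) one_T] phi_one x(3) by simp
    ultimately show "\<phi> x = q (4 * p) False"
      using involution_cases[OF S_in[OF x_S]] reflection_notin_closed_nrt[OF S closed] x_S by metis
  qed
  \<comment> \<open>The two involutions of the loop on \<open>T\<close> represent the cosets of
    \<open>b\<close> and \<open>a^(2 * p)\<close>: both have squares in the centre, and their flags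
    differ.\<close>
  obtain x where x: "x \<in> T" "x \<in> ?Z #> q 0 True"
    using nrts_ex1[OF T q_in Z.is_subgroup] by blast
  obtain y where y: "y \<in> T" "y \<in> ?Z #> q (2 * p) False"
    using nrts_ex1[OF T q_in Z.is_subgroup] by blast
  from x(2) have x_cases: "x = q 0 True \<or> x = q (4 * p) True"
    by (auto simp: r_coset_def one_eq q_mult)
  from y(2) have y_cases: "y = q (2 * p) False \<or> y = q (6 * p) False"
    by (auto simp: r_coset_def one_eq q_mult)
  have "x \<otimes> x \<in> ?Z" "x \<noteq> \<one>"
    using x_cases by (auto simp: q_mult one_eq q_eq_iff algebra_simps)
  moreover have "y \<otimes> y \<in> ?Z"
    using y_cases by (auto simp: q_mult one_eq q_eq_iff)
  moreover have "y \<noteq> \<one>"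
    using y_cases p_pos zdvd_imp_le[of "8 * p" "2 * p"] zdvd_imp_le[of "8 * p" "6 * p"]
    by (force simp: one_eq q_eq_iff)
  ultimately have "\<phi> x = \<phi> y" using involution(2) x(1) y(1) by metis
  then have "x = y" using inj x(1) y(1) by (simp add: inj_on_eq_iff)
  then show False using x_cases y_cases by (auto simp: q_eq_iff)
qed

lemma not_complete_transiso_graph_2: "\<not> complete_graph (transiso_graph G 2)"
proof
  let ?H = "{\<one>, q 0 True}" and ?Z = "{\<one>, q (4 * p) False}"
  assume c: "complete_graph (transiso_graph G 2)"
  have neq: "\<one> \<noteq> q 0 True" "\<one> \<noteq> q (4 * p) False" "q (4 * p) False \<noteq> q 0 True"
    using p_pos zdvd_imp_le[of "8 * p" "4 * p"] by (auto simp: one_eq q_eq_iff)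
  then have "card ?Z = 2" "card ?H = 2" "?Z \<noteq> ?H" by (auto simp: doubleton_eq_iff)
  then have "\<exists>T \<in> nrts G ?Z. \<exists>S \<in> nrts G ?H. nrt_loop G ?Z T \<cong> nrt_loop G ?H S"
    using normal_imp_subgroup[OF normal_center] subgroup_reflection
    by (intro c[unfolded complete_transiso_graph_iff, rule_format] conjI)
  then show False using reflection_center_not_iso by blast
qed

section \<open>The remaining orders\<close>

text \<open>Comparing orders, the case of rotations only would need \<open>2 * c = 1\<close>; the
  other case gives \<open>c = 1\<close>, which admits every element.\<close>

lemma subgroup_eq_carrier:
  assumes U: "subgroup U G" and card: "int (card U) = 16 * p"
  shows "U = carrier G"
proof -
  from U have "q i e \<in> U" for i e
  proof (cases rule: subgroup_cases)
    case (cyclic c)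
    then have "8 * p * (2 * c) = 8 * p * 1" using card by simp
    then have "2 * c = 1" using p_pos by (simp only: mult_cancel_left) simp
    then have False by presburger
    then show ?thesis ..
  next
    case (noncyclic c t)
    then have "c = 1" using card p_pos by simp
    then show ?thesis using noncyclic(2) by simp
  qed
  then show ?thesis using subgroup.subset[OF U] by (auto elim: carrierE)
qed

lemma complete_transiso_graph:
  assumes "4 dvd d" "int d * l = 8 * p"
  shows "complete_graph (transiso_graph G d)"
  unfolding complete_transiso_graph_iff
proof (intro allI impI, elim conjE)
  fix H K assume H: "subgroup H G" "card H = d" and K: "subgroup K G" "card K = d"
  obtain S where S: "S \<in> nrts G H" "dihedral_loop l \<cong> nrt_loop G H S"
    using exists_dihedral_transversal[OF H(1), of l] H(2) assms by auto
  obtain T where T: "T \<in> nrts G K" "dihedral_loop l \<cong> nrt_loop G K T"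
    using exists_dihedral_transversal[OF K(1), of l] K(2) assms by auto
  have "nrt_loop G H S \<cong> dihedral_loop l"
    using S(2) dihedral_loop_closed by (rule is_iso_sym_of_closed)
  then have "nrt_loop G H S \<cong> nrt_loop G K T" using T(2) by (rule iso_trans)
  then show "\<exists>S \<in> nrts G H. \<exists>T \<in> nrts G K. nrt_loop G H S \<cong> nrt_loop G K T"
    using S(1) T(1) by blast
qed

end

lemma presentation_eq_quasidihedral:
  assumes "n > 4"
  shows "quasidihedral n = presented_group (qd_relators (2 ^ (n - 4)))"
proof -
  have "n - 1 = n - 4 + 3" "n - 2 = n - 4 + 2" using assms by simp_all
  then have "2 ^ (n - 1) = 8 * (2 :: nat) ^ (n - 4)" "2 ^ (n - 2) = 4 * (2 :: nat) ^ (n - 4)"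
    by (simp_all only: power_add) simp_all
  then show ?thesis by (simp add: quasidihedral_def qd_relators_def)
qed

theorem proposition3p4:
  fixes G :: "('a, 'b) monoid_scheme" and n m d :: nat
  assumes "n > 4"
    and "group G" and "G \<cong> quasidihedral n"
    and "d = 2 ^ m" and "d dvd 2 ^ n"
  shows "complete_graph (transiso_graph G d) \<longleftrightarrow> d \<noteq> 2"
proof -
  define p :: int where "p = 2 ^ (n - 4)"
  obtain q' where "qd_coordinates (quasidihedral n) q' p"
    using presented_group_coordinates[of "2 ^ (n - 4)"]
    by (auto simp: presentation_eq_quasidihedral[OF assms(1)] p_def)
  with assms(2,3) obtain q where "qd_coordinates G q p" using qd_coordinates_iso by blast
  then interpret qd_coordinates G q p .
  have "(2 :: int) ^ n = 2 ^ (n - 4 + 4)" using assms(1) by simp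
  then have p: "2 ^ n = 16 * p" unfolding power_add p_def by simp
  have "m \<le> n" using assms(4,5) by (simp add: power_dvd_imp_le)
  have "complete_graph (transiso_graph G d)" if "d \<noteq> 2"
  proof -
    have "m \<noteq> 1" using that assms(4) by auto
    with \<open>m \<le> n\<close> consider "m = 0" | "m = n" | "2 \<le> m" "m < n" by linarith
    then show ?thesis
    proof cases
      case 1
      then have "U = {\<one>\<^bsub>G\<^esub>}" if "subgroup U G" "card U = d" for U
        using that subgroup.one_closed[OF that(1)] assms(4) by (auto simp: card_1_singleton_iff)
      then show ?thesis unfolding complete_transiso_graph_iff by metis
    next
      case 2
      then have "int d = 16 * p" using assms(4) p by simp
      then show ?thesis
        unfolding complete_transiso_graph_iff using subgroup_eq_carrier by metis
    next
      case 3
      have "2 ^ 2 dvd d" unfolding assms(4) using 3(1) by (rule le_imp_power_dvd)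
      \<comment> \<open>The required \<open>l\<close> is \<open>2 ^ (n - 1 - m)\<close>;
        \<open>m < n\<close> makes the natural subtraction exact.\<close>
      moreover have "2 * (int d * 2 ^ (n - 1 - m)) = 2 ^ (1 + m + (n - 1 - m))"
        by (simp add: assms(4) power_add)
      then have "int d * 2 ^ (n - 1 - m) = 8 * p" using 3(2) p by simp
      ultimately show ?thesis by (intro complete_transiso_graph) simp_all
    qed
  qed
  then show ?thesis using not_complete_transiso_graph_2 by blast
qed

end
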